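(* Let $V:\mathbb{R}\to\mathbb{R}$ and $W:\mathbb{R}\to\mathbb{R}$ be functions with $W(x)=W(-x)$ for all $x$, and let $[a,b]$ be partitioned into $N$ (possibly nonuniform) cells as in the context. For a time step $\tau>0$, consider the fully discrete scheme which computes $\rho^{n+1}=(\rho^{n+1}_1,\dots,\rho^{n+1}_N)$ from $\rho^n$ by $$\frac{\rho_j^{n+1}-\rho_j^n}{\tau}=\frac{C^{n,*}_{j+1/2}-C^{n,*}_{j-1/2}}{h_j},\qquad j=1,\dots,N,$$ with the fluxes $C^{n,*}_{j+1/2}$ defined in the context. Then: (1) Conservation of mass: if $\rho^0_j=\frac1{h_j}\int_{I_j}\rho_0(x)\,dx$ for all $j$, where $\rho_0$ is the (integrable) initial datum on $\Omega=[a,b]$, then $$\sum_{j=1}^N h_j\rho_j^n=\int_\Omega\rho_0(x)\,dx\qquad\text{for } n\ge 1.$$ (2) Positivity preserving (for every $\tau>0$): if $\rho_j^n\ge 0$ for all $j=1,\dots,N$, then $\rho_j^{n+1}\ge 0$ for all $j=1,\dots,N$. (3) Entropy dissipation: let $\rho^n$ be given with $\rho^n_j\ge 0$ for all $j$ and $\rho^n\neq 0$. There exists $\tau^*>0$ such that if $\tau\in(0,\tau^* )$, then $$E_h^{n+1}-E_h^n\le -\frac{\tau}{2}I_h^n,$$ where $$I_h^n=\sum_{j=1}^{N-1}C^{n,*}_{j+1/2}\left(\log\frac{\rho^{n+1}_{j+1}}{M^n_{j+1}}-\log\frac{\rho^{n+1}_j}{M^n_j}\right)\ge 0.$$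
   Context: Mesh: $\Omega=[a,b]$ is partitioned into cells $I_j=[x_{j-1/2},x_{j+1/2}]$, $j=1,\dots,N$, with $x_{1/2}=a$, $x_{N+1/2}=b$, sizes $h_j=|I_j|>0$, and centers $x_j=x_{j-1/2}+\frac12 h_j$. Set $h_{j+1/2}=(h_j+h_{j+1})/2$. For $x\in\mathbb{R}$ and $v\in\mathbb{R}^N$ define $$Q_1(x,v)=\exp\Big(-V(x)-\sum_{i=1}^N h_iW(x_i-x)v_i\Big),$$ and set $M^n_{j+1/2}=Q_1(x_{j+1/2},\rho^n)$, $M^n_j=Q_1(x_j,\rho^n)$. The fluxes are $$C^{n,*}_{j+1/2}=\frac{M^n_{j+1/2}}{h_{j+1/2}}\left(\frac{\rho^{n+1}_{j+1}}{M^n_{j+1}}-\frac{\rho^{n+1}_j}{M^n_j}\right)\ \ (j=1,\dots,N-1),\qquad C^{n,*}_{1/2}=C^{n,*}_{N+1/2}=0.$$ Each step is thus a linear system for $\rho^{n+1}$. The discrete free energy is $$E_h^n=\sum_{j=1}^N h_j\Big(\rho_j^n\log\rho_j^n+V(x_j)\rho_j^n+\tfrac12 g_j^n\rho_j^n\Big),\qquad g_j^n=\sum_{i=1}^N h_iW(x_i-x_j)\rho_i^n,$$ with the convention $0\log 0=0$. In (3), $\rho^{n+1}$ is the result of one step with time step $\tau$ from the given $\rho^n$; $\tau^*$ may depend on $\rho^n$, the mesh, $V$ and $W$. *)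

theory Defs
  imports "HOL-Analysis.Analysis"
begin

text \<open>
  Conventions. A vector of \<open>\<real>\<^sup>N\<close> is a function \<open>nat \<Rightarrow> real\<close> of which only the values at the
  indices \<open>1, \<dots>, N\<close> are used. Half-integer indices are shifted down by one half: the mesh is
  given by its nodes \<open>xh\<close>, where \<open>xh j\<close> stands for \<open>x\<^bsub>j+1/2\<^esub>\<close>, \<open>j = 0, \<dots>, N\<close>, and likewise
  \<open>width_half xh j\<close>, \<open>M_half \<dots> j\<close> and \<open>flux \<dots> j\<close> stand for the quantities with index \<open>j+1/2\<close>.
  Throughout, \<open>u\<close> is \<open>\<rho>\<^sup>n\<close> and \<open>w\<close> is \<open>\<rho>\<^bsup>n+1\<^esup>\<close>.
\<close>

definition mesh :: "real \<Rightarrow> real \<Rightarrow> nat \<Rightarrow> (nat \<Rightarrow> real) \<Rightarrow> bool" where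
  "mesh a b N xh \<longleftrightarrow>
     N \<ge> 1 \<and> xh 0 = a \<and> xh N = b \<and> (\<forall>j\<in>{1..N}. xh (j - 1) < xh j)"

definition cell :: "(nat \<Rightarrow> real) \<Rightarrow> nat \<Rightarrow> real set" where
  "cell xh j = {xh (j - 1)..xh j}"

definition width :: "(nat \<Rightarrow> real) \<Rightarrow> nat \<Rightarrow> real" where
  "width xh j = xh j - xh (j - 1)"

definition center :: "(nat \<Rightarrow> real) \<Rightarrow> nat \<Rightarrow> real" where
  "center xh j = xh (j - 1) + width xh j / 2"

definition width_half :: "(nat \<Rightarrow> real) \<Rightarrow> nat \<Rightarrow> real" where
  "width_half xh j = (width xh j + width xh (j + 1)) / 2"

definition Q1 ::
  "(real \<Rightarrow> real) \<Rightarrow> (real \<Rightarrow> real) \<Rightarrow> nat \<Rightarrow> (nat \<Rightarrow> real) \<Rightarrow> real \<Rightarrow> (nat \<Rightarrow> real) \<Rightarrow> real" where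
  "Q1 V W N xh x v = exp (- V x - (\<Sum>i=1..N. width xh i * W (center xh i - x) * v i))"

definition M_half ::
  "(real \<Rightarrow> real) \<Rightarrow> (real \<Rightarrow> real) \<Rightarrow> nat \<Rightarrow> (nat \<Rightarrow> real) \<Rightarrow> (nat \<Rightarrow> real) \<Rightarrow> nat \<Rightarrow> real" where
  "M_half V W N xh u j = Q1 V W N xh (xh j) u"

definition M_cell ::
  "(real \<Rightarrow> real) \<Rightarrow> (real \<Rightarrow> real) \<Rightarrow> nat \<Rightarrow> (nat \<Rightarrow> real) \<Rightarrow> (nat \<Rightarrow> real) \<Rightarrow> nat \<Rightarrow> real" where
  "M_cell V W N xh u j = Q1 V W N xh (center xh j) u"

text \<open>The zero branch is the no-flux boundary condition at \<open>j = 0\<close> and \<open>j = N\<close>.\<close>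

definition flux ::
  "(real \<Rightarrow> real) \<Rightarrow> (real \<Rightarrow> real) \<Rightarrow> nat \<Rightarrow> (nat \<Rightarrow> real) \<Rightarrow>
   (nat \<Rightarrow> real) \<Rightarrow> (nat \<Rightarrow> real) \<Rightarrow> nat \<Rightarrow> real" where
  "flux V W N xh u w j =
     (if 1 \<le> j \<and> j < N
      then M_half V W N xh u j / width_half xh j *
           (w (j + 1) / M_cell V W N xh u (j + 1) - w j / M_cell V W N xh u j)
      else 0)"

definition scheme_step ::
  "(real \<Rightarrow> real) \<Rightarrow> (real \<Rightarrow> real) \<Rightarrow> nat \<Rightarrow> (nat \<Rightarrow> real) \<Rightarrow> real \<Rightarrow>
   (nat \<Rightarrow> real) \<Rightarrow> (nat \<Rightarrow> real) \<Rightarrow> bool" where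
  "scheme_step V W N xh \<tau> u w \<longleftrightarrow>
     (\<forall>j\<in>{1..N}. (w j - u j) / \<tau> =
        (flux V W N xh u w j - flux V W N xh u w (j - 1)) / width xh j)"

definition interaction ::
  "(real \<Rightarrow> real) \<Rightarrow> nat \<Rightarrow> (nat \<Rightarrow> real) \<Rightarrow> (nat \<Rightarrow> real) \<Rightarrow> nat \<Rightarrow> real" where
  "interaction W N xh u j = (\<Sum>i=1..N. width xh i * W (center xh i - center xh j) * u i)"

text \<open>The convention \<open>0 log 0 = 0\<close> needs no case distinction, since \<open>0 * ln 0 = 0\<close>.\<close>

definition free_energy ::
  "(real \<Rightarrow> real) \<Rightarrow> (real \<Rightarrow> real) \<Rightarrow> nat \<Rightarrow> (nat \<Rightarrow> real) \<Rightarrow> (nat \<Rightarrow> real) \<Rightarrow> real" where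
  "free_energy V W N xh u =
     (\<Sum>j=1..N. width xh j *
        (u j * ln (u j) + V (center xh j) * u j + 1/2 * interaction W N xh u j * u j))"

text \<open>
  If \<open>w\<close> is obtained from a nonnegative \<open>u \<noteq> 0\<close> by one step with \<open>\<tau> > 0\<close>, then \<open>w j > 0\<close> for all
  \<open>j\<close>, so that the logarithms are only taken of positive numbers.
\<close>

definition dissipation ::
  "(real \<Rightarrow> real) \<Rightarrow> (real \<Rightarrow> real) \<Rightarrow> nat \<Rightarrow> (nat \<Rightarrow> real) \<Rightarrow>
   (nat \<Rightarrow> real) \<Rightarrow> (nat \<Rightarrow> real) \<Rightarrow> real" where
  "dissipation V W N xh u w =
     (\<Sum>j=1..N - 1. flux V W N xh u w j *
        (ln (w (j + 1) / M_cell V W N xh u (j + 1)) - ln (w j / M_cell V W N xh u j)))"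

end

theory Submission
  imports Defs
begin

text \<open>
  Because \<open>M\<close> is evaluated at the old density \<open>u\<close>, one step is an implicit diffusion step on a path
  with \<open>N\<close> vertices for the relative density \<open>q = w / M\<close>: each flux is a positive conductance times
  a difference of neighbouring values of \<open>q\<close>. Everything follows from this form.

  Mass is conserved because the fluxes telescope and vanish at both ends (\<open>mass_conservation\<close>).

  Positivity is a minimum principle (\<open>scheme_step_nonneg\<close>): in a cell where \<open>q\<close> is minimal mass can
  only flow in, so \<open>w \<ge> u \<ge> 0\<close> there. If this minimum is zero, nothing flows in at all, hence the
  neighbours vanish as well, and so do, by connectedness of the path, \<open>w\<close> and \<open>u\<close>. A nonzero \<open>u\<close>
  therefore makes \<open>w\<close> strictly positive (\<open>scheme_step_pos\<close>).

  For the energy, convexity of \<open>s log s\<close> and the expansion of the symmetric interaction energy around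
  \<open>u\<close> bound the increment by the sum of \<open>h (w - u) log q\<close>, which is \<open>- \<tau> I\<close> after summation by
  parts, plus half of the interaction form evaluated at \<open>w - u\<close> (\<open>free_energy_increment\<close>).
  Since \<open>h (w - u)\<close> is \<open>\<tau>\<close> times a difference of fluxes \<open>C\<close>, this form is at most
  \<open>\<tau>\<^sup>2 L \<Sum> C\<^sup>2\<close> (\<open>remainder_bound\<close>). Conversely \<open>\<Sum> C\<^sup>2 \<le> k Q I\<close> whenever \<open>0 < q \<le> Q\<close>
  (\<open>flux_squared_le_dissipation\<close>), because the logarithm has slope at least \<open>1 / Q\<close> on
  \<open>(0, Q]\<close>. The decisive point is that \<open>Q\<close> can be chosen independently of \<open>\<tau>\<close>: positivity and
  conservation of mass bound \<open>w\<close> by data of the old step alone (\<open>rel_density_bound\<close>). Hence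
  \<open>\<tau> L k Q \<le> 1\<close> makes the remainder cost at most half of the dissipation.
\<close>

section \<open>The scheme as a weighted graph diffusion\<close>

text \<open>
  The density relative to the Gibbs-type weight \<open>M\<close>; it is constant exactly at the equilibria of
  the linear step with \<open>u\<close> frozen.
\<close>

definition rel_density ::
  "(real \<Rightarrow> real) \<Rightarrow> (real \<Rightarrow> real) \<Rightarrow> nat \<Rightarrow> (nat \<Rightarrow> real) \<Rightarrow>
   (nat \<Rightarrow> real) \<Rightarrow> (nat \<Rightarrow> real) \<Rightarrow> nat \<Rightarrow> real" where
  "rel_density V W N xh u w j = w j / M_cell V W N xh u j"

definition conductance ::
  "(real \<Rightarrow> real) \<Rightarrow> (real \<Rightarrow> real) \<Rightarrow> nat \<Rightarrow> (nat \<Rightarrow> real) \<Rightarrow> (nat \<Rightarrow> real) \<Rightarrow> nat \<Rightarrow> real" where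
  "conductance V W N xh u j = M_half V W N xh u j / width_half xh j"

lemma width_pos:
  assumes "mesh a b N xh" "j \<in> {1..N}"
  shows "width xh j > 0"
  using assms by (auto simp: mesh_def width_def)

lemma M_cell_pos: "M_cell V W N xh u j > 0"
  by (simp add: M_cell_def Q1_def)

lemma ln_M_cell:
  "ln (M_cell V W N xh u j) = - V (center xh j) - interaction W N xh u j"
  by (simp add: M_cell_def Q1_def interaction_def)

lemma conductance_pos:
  assumes "mesh a b N xh" "1 \<le> j" "j < N"
  shows "conductance V W N xh u j > 0"
proof -
  have "width xh j > 0" "width xh (j + 1) > 0"
    using assms by (auto intro!: width_pos[OF assms(1)])
  thus ?thesis
    by (simp add: conductance_def M_half_def Q1_def width_half_def)
qed

lemma flux_eq_conductance:
  assumes "1 \<le> j" "j < N"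
  shows "flux V W N xh u w j = conductance V W N xh u j *
           (rel_density V W N xh u w (j + 1) - rel_density V W N xh u w j)"
  using assms by (simp add: flux_def conductance_def rel_density_def)

lemma flux_boundary [simp]:
  "flux V W N xh u w 0 = 0" "flux V W N xh u w N = 0"
  by (simp_all add: flux_def)

lemma scheme_step_balance:
  assumes "mesh a b N xh" "\<tau> > 0" "scheme_step V W N xh \<tau> u w" "j \<in> {1..N}"
  shows "width xh j * (w j - u j) = \<tau> * (flux V W N xh u w j - flux V W N xh u w (j - 1))"
proof -
  have "(w j - u j) / \<tau> = (flux V W N xh u w j - flux V W N xh u w (j - 1)) / width xh j"
    using assms(3,4) by (auto simp: scheme_step_def)
  thus ?thesis
    using assms(2) width_pos[OF assms(1,4)] by (simp add: field_simps)
qed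

text \<open>
  The boundary term at \<open>N\<close> is kept for the sake of the induction on \<open>N\<close>; for the fluxes it vanishes.
\<close>

lemma summation_by_parts:
  fixes F \<phi> :: "nat \<Rightarrow> 'a::comm_ring"
  assumes "F 0 = 0"
  shows "(\<Sum>j=1..N. (F j - F (j - 1)) * \<phi> j) =
           F N * \<phi> N - (\<Sum>j=1..N - 1. F j * (\<phi> (j + 1) - \<phi> j))"
proof (induction N)
  case 0
  thus ?case using assms by simp
next
  case (Suc N)
  have "(\<Sum>j=1..N. F j * (\<phi> (j + 1) - \<phi> j)) =
        (\<Sum>j=1..N - 1. F j * (\<phi> (j + 1) - \<phi> j)) + F N * (\<phi> (N + 1) - \<phi> N)"
    by (cases N) (simp_all add: assms)
  moreover have "(\<Sum>j=1..Suc N. (F j - F (j - 1)) * \<phi> j) =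
        (\<Sum>j=1..N. (F j - F (j - 1)) * \<phi> j) + (F (N + 1) - F N) * \<phi> (N + 1)"
    by simp
  ultimately show ?case
    unfolding Suc.IH by (simp only: diff_Suc_1) (simp add: left_diff_distrib right_diff_distrib)
qed

section \<open>Conservation of mass\<close>

lemma mass_conservation:
  assumes "mesh a b N xh" "\<tau> > 0" "scheme_step V W N xh \<tau> u w"
  shows "(\<Sum>j=1..N. width xh j * w j) = (\<Sum>j=1..N. width xh j * u j)"
proof -
  have "(\<Sum>j=1..N. width xh j * w j) - (\<Sum>j=1..N. width xh j * u j)
        = (\<Sum>j=1..N. \<tau> * (flux V W N xh u w j - flux V W N xh u w (j - 1)))"
    using scheme_step_balance[OF assms]
    by (simp add: sum_subtractf[symmetric] right_diff_distrib[symmetric])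
  also have "\<dots> = 0"
    using summation_by_parts[where F = "flux V W N xh u w" and N = N and \<phi> = "\<lambda>_. 1"]
    by (simp add: sum_distrib_left[symmetric])
  finally show ?thesis by simp
qed

lemma mesh_node_mono:
  assumes "mesh a b N xh" "i \<le> j" "j \<le> N"
  shows "xh i \<le> xh j"
  using assms(2,3)
proof (induction j rule: dec_induct)
  case (step j)
  have "xh j < xh (Suc j)"
    using assms(1) step.prems unfolding mesh_def by (metis Suc_diff_1 Suc_le_eq atLeastAtMost_iff
      diff_Suc_1 le_add1 plus_1_eq_Suc)
  with step show ?case by simp
qed simp

lemma sum_cell_integrals:
  fixes f :: "real \<Rightarrow> real"
  assumes mesh: "mesh a b N xh" and f: "f absolutely_integrable_on {a..b}"
  shows "(\<Sum>j=1..N. LINT x:cell xh j|lebesgue. f x) = (LINT x:{a..b}|lebesgue. f x)"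
proof -
  have ends: "xh 0 = a" "xh N = b"
    using mesh by (auto simp: mesh_def)
  have sub: "f absolutely_integrable_on {xh i..xh j}" if "i \<le> j" "j \<le> N" for i j
  proof (rule set_integrable_subset[OF f])
    show "{xh i..xh j} \<subseteq> {a..b}"
      using mesh_node_mono[OF mesh, of 0 i] mesh_node_mono[OF mesh, of j N] that ends by auto
  qed simp
  have "(\<Sum>j=1..m. LINT x:cell xh j|lebesgue. f x) = integral {xh 0..xh m} f"
    if "m \<le> N" for m
    using that
  proof (induction m)
    case (Suc m)
    have "(LINT x:cell xh (Suc m)|lebesgue. f x) = integral {xh m..xh (Suc m)} f"
      using set_lebesgue_integral_eq_integral(2)[OF sub[of m "Suc m"]] Suc.prems
      by (simp add: cell_def)
    moreover have "integral {xh 0..xh m} f + integral {xh m..xh (Suc m)} f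
                     = integral {xh 0..xh (Suc m)} f"
      using Suc.prems sub[of 0 "Suc m"]
      by (intro Henstock_Kurzweil_Integration.integral_combine
            mesh_node_mono[OF mesh] set_lebesgue_integral_eq_integral(1)) auto
    ultimately show ?case using Suc by simp
  qed simp
  from this[of N] show ?thesis
    using set_lebesgue_integral_eq_integral(2)[OF f] ends by simp
qed

section \<open>Positivity\<close>

text \<open>
  Fluxes run along differences of the relative density, so both differences at a minimal cell have
  a known sign. At the ends of the mesh the missing neighbour is replaced by the no-flux condition.
\<close>

lemma flux_signs_at_minimum:
  assumes mesh: "mesh a b N xh" and j: "j \<in> {1..N}"
    and min: "\<And>i. i \<in> {1..N} \<Longrightarrow> rel_density V W N xh u w j \<le> rel_density V W N xh u w i"
  shows "flux V W N xh u w j \<ge> 0" "flux V W N xh u w (j - 1) \<le> 0"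
proof -
  show "flux V W N xh u w j \<ge> 0"
  proof (cases "j < N")
    case True
    with j min[of "j + 1"] conductance_pos[OF mesh, of j V W u] show ?thesis
      by (simp add: flux_eq_conductance less_imp_le)
  next
    case False
    with j show ?thesis by simp
  qed
  show "flux V W N xh u w (j - 1) \<le> 0"
  proof (cases "j = 1")
    case False
    with j have i: "1 \<le> j - 1" "j - 1 < N" "j - 1 + 1 = j" by auto
    have "rel_density V W N xh u w j \<le> rel_density V W N xh u w (j - 1)"
      using i by (intro min) auto
    with conductance_pos[OF mesh i(1,2)] show ?thesis
      unfolding flux_eq_conductance[OF i(1,2)] i(3) by (simp add: mult_nonneg_nonpos less_imp_le)
  qed simp
qed

lemma rel_density_minimum:
  assumes "mesh a b N xh"
  obtains j where "j \<in> {1..N}"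
    "\<And>i. i \<in> {1..N} \<Longrightarrow> rel_density V W N xh u w j \<le> rel_density V W N xh u w i"
proof -
  have "finite {1..N}" "{1..N} \<noteq> {}"
    using assms by (auto simp: mesh_def)
  from arg_min_if_finite(1)[OF this] arg_min_least[OF this]
  show thesis
    by (rule that[of "arg_min_on (rel_density V W N xh u w) {1..N}"])
qed

text \<open>
  The minimum principle is applied to \<open>w / M\<close> rather than to \<open>w\<close>: at its minimum the net inflow is
  nonnegative, so \<open>w\<close> is nonnegative there, and a nonnegative minimum of \<open>w / M\<close> suffices everywhere.
\<close>

lemma scheme_step_nonneg:
  assumes mesh: "mesh a b N xh" and tau: "\<tau> > 0" and step: "scheme_step V W N xh \<tau> u w"
    and u: "\<And>j. j \<in> {1..N} \<Longrightarrow> u j \<ge> 0" and i: "i \<in> {1..N}"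
  shows "w i \<ge> 0"
proof -
  obtain j where j: "j \<in> {1..N}"
    "\<And>i. i \<in> {1..N} \<Longrightarrow> rel_density V W N xh u w j \<le> rel_density V W N xh u w i"
    using rel_density_minimum[OF mesh, where V = V and W = W and u = u and w = w] by blast
  have "width xh j * (w j - u j) \<ge> 0"
    using scheme_step_balance[OF mesh tau step j(1)] flux_signs_at_minimum[OF mesh j] tau
    by simp
  hence "w j \<ge> 0"
    using width_pos[OF mesh j(1)] u[OF j(1)] by (simp add: zero_le_mult_iff)
  hence "0 \<le> rel_density V W N xh u w j"
    using M_cell_pos[of V W N xh u j] by (simp add: rel_density_def)
  also have "\<dots> \<le> rel_density V W N xh u w i"
    using j i by simp
  finally show ?thesis
    using M_cell_pos[of V W N xh u i] by (simp add: rel_density_def zero_le_divide_iff)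
qed

text \<open>
  A zero of \<open>w\<close> is a minimum of \<open>w / M\<close>, so the net inflow there is nonnegative; it also equals
  \<open>- h u \<le> 0\<close>. Thus it vanishes, together with both fluxes, and a vanishing flux through a
  positive conductance forces equal relative densities on its two sides.
\<close>

lemma zero_propagates:
  assumes mesh: "mesh a b N xh" and tau: "\<tau> > 0" and step: "scheme_step V W N xh \<tau> u w"
    and u: "\<And>j. j \<in> {1..N} \<Longrightarrow> u j \<ge> 0" and j: "j \<in> {1..N}" and zero: "w j = 0"
  shows "u j = 0" "j < N \<Longrightarrow> w (j + 1) = 0" "1 < j \<Longrightarrow> w (j - 1) = 0"
proof -
  have min: "rel_density V W N xh u w j \<le> rel_density V W N xh u w i" if "i \<in> {1..N}" for i
    using scheme_step_nonneg[OF mesh tau step u that] M_cell_pos[of V W N xh u i] zero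
    by (simp add: rel_density_def)
  note signs = flux_signs_at_minimum[OF mesh j min]
  have "width xh j * u j \<ge> 0"
    using width_pos[OF mesh j] u[OF j] by simp
  moreover have "- (width xh j * u j) = \<tau> * (flux V W N xh u w j - flux V W N xh u w (j - 1))"
    using scheme_step_balance[OF mesh tau step j] zero by simp
  moreover have "\<tau> * (flux V W N xh u w j - flux V W N xh u w (j - 1)) \<ge> 0"
    using signs tau by simp
  ultimately have "width xh j * u j = 0"
    and "\<tau> * (flux V W N xh u w j - flux V W N xh u w (j - 1)) = 0" by linarith+
  with tau signs width_pos[OF mesh j]
  have *: "u j = 0" "flux V W N xh u w j = 0" "flux V W N xh u w (j - 1) = 0" by auto
  show "u j = 0" by fact
  show "w (j + 1) = 0" if "j < N"
    using flux_eq_conductance[of j N V W xh u w] conductance_pos[OF mesh, of j V W u] that j * zero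
      M_cell_pos[of V W N xh u "j + 1"]
    by (auto simp: rel_density_def)
  show "w (j - 1) = 0" if "1 < j"
  proof -
    have i: "1 \<le> j - 1" "j - 1 < N" "j - 1 + 1 = j" using that j by auto
    show ?thesis
      using flux_eq_conductance[OF i(1,2), of V W xh u w] conductance_pos[OF mesh i(1,2), of V W u]
        * zero M_cell_pos[of V W N xh u "j - 1"]
      unfolding i(3) by (auto simp: rel_density_def)
  qed
qed

lemma scheme_step_pos:
  assumes mesh: "mesh a b N xh" and tau: "\<tau> > 0" and step: "scheme_step V W N xh \<tau> u w"
    and u: "\<And>j. j \<in> {1..N} \<Longrightarrow> u j \<ge> 0" and nz: "\<exists>j\<in>{1..N}. u j \<noteq> 0" and i: "i \<in> {1..N}"
  shows "w i > 0"
proof (rule ccontr)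
  assume "\<not> w i > 0"
  with scheme_step_nonneg[OF mesh tau step u i] have wi: "w i = 0" by simp
  note spread = zero_propagates[OF mesh tau step u]
  have "w j = 0" if "i \<le> j" "j \<le> N" for j
    using that
  proof (induction j rule: dec_induct)
    case (step j)
    then show ?case using spread(2)[of j] i by simp
  qed (rule wi)
  moreover have "w j = 0" if "j \<le> i" "1 \<le> j" for j
    using that
  proof (induction j rule: inc_induct)
    case (step j)
    then show ?case using spread(3)[of "Suc j"] i by simp
  qed (rule wi)
  ultimately have "w j = 0" if "j \<in> {1..N}" for j
    using that by (meson atLeastAtMost_iff linear)
  with spread(1) nz show False by blast
qed

text \<open>
  No cell can hold more than the total mass, which is that of \<open>u\<close>. The bound depends neither on \<open>\<tau>\<close>
  nor on \<open>w\<close>, and this is what allows a threshold for \<open>\<tau>\<close> that depends on \<open>u\<close> alone.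
\<close>

lemma rel_density_bound:
  assumes mesh: "mesh a b N xh" and tau: "\<tau> > 0" and step: "scheme_step V W N xh \<tau> u w"
    and u: "\<And>j. j \<in> {1..N} \<Longrightarrow> u j \<ge> 0" and i: "i \<in> {1..N}"
  shows "rel_density V W N xh u w i \<le>
           (\<Sum>j=1..N. width xh j * u j) * (\<Sum>j=1..N. 1 / (width xh j * M_cell V W N xh u j))"
proof -
  have h: "\<And>j. j \<in> {1..N} \<Longrightarrow> width xh j > 0" using width_pos[OF mesh] .
  have "width xh i * w i \<le> (\<Sum>j=1..N. width xh j * w j)"
    using i h scheme_step_nonneg[OF mesh tau step u]
    by (intro member_le_sum) (auto simp: less_imp_le)
  also have "\<dots> = (\<Sum>j=1..N. width xh j * u j)"
    by (rule mass_conservation[OF mesh tau step])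
  finally have mass: "width xh i * w i \<le> (\<Sum>j=1..N. width xh j * u j)" .
  have "rel_density V W N xh u w i = (width xh i * w i) * (1 / (width xh i * M_cell V W N xh u i))"
    using h[OF i] by (simp add: rel_density_def)
  also have "\<dots> \<le> (\<Sum>j=1..N. width xh j * u j) * (\<Sum>j=1..N. 1 / (width xh j * M_cell V W N xh u j))"
  proof (rule mult_mono[OF mass])
    show "1 / (width xh i * M_cell V W N xh u i) \<le> (\<Sum>j=1..N. 1 / (width xh j * M_cell V W N xh u j))"
      using i h M_cell_pos[of V W N xh u]
      by (intro member_le_sum[of i _ "\<lambda>j. 1 / (width xh j * M_cell V W N xh u j)"])
         (auto simp: less_imp_le)
  qed (use h[OF i] h M_cell_pos[of V W N xh u] u in \<open>auto intro!: sum_nonneg simp: less_imp_le\<close>)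
  finally show ?thesis .
qed

section \<open>Decay of the free energy up to a quadratic remainder\<close>

text \<open>
  The tangent of the convex function \<open>s log s\<close> at \<open>w\<close>. The tangent is taken at the new value because
  that one is strictly positive; \<open>u = 0\<close> is covered by the convention \<open>0 log 0 = 0\<close>.
\<close>

lemma entropy_convexity:
  fixes u w :: real
  assumes "u \<ge> 0" "w > 0"
  shows "w * ln w - u * ln u \<le> (w - u) * (1 + ln w)"
proof (cases "u = 0")
  case False
  with assms have "u * (ln w - ln u) \<le> u * (w / u - 1)"
    using ln_le_minus_one[of "w / u"] by (intro mult_left_mono) (auto simp: ln_div)
  also have "\<dots> = w - u" using False by (simp add: field_simps)
  finally show ?thesis by (simp add: algebra_simps)
qed (use assms in \<open>simp add: algebra_simps\<close>)

lemma interaction_symmetric: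
  assumes "\<And>x. W x = W (- x)"
  shows "(\<Sum>j=1..N. width xh j * interaction W N xh u j * v j) =
         (\<Sum>j=1..N. width xh j * interaction W N xh v j * u j)"
proof -
  have even: "W (center xh i - center xh j) = W (center xh j - center xh i)" for i j
    using assms[of "center xh i - center xh j"] by simp
  show ?thesis
    unfolding interaction_def sum_distrib_left sum_distrib_right
    by (subst sum.swap) (intro sum.cong refl, subst even, simp add: mult_ac)
qed

lemma interaction_diff:
  "interaction W N xh (\<lambda>i. w i - u i) j = interaction W N xh w j - interaction W N xh u j"
  by (simp add: interaction_def right_diff_distrib sum_subtractf)

text \<open>
  The second order expansion of a quadratic form around \<open>u\<close>, exact without further remainder; the
  evenness of \<open>W\<close> makes the two mixed terms equal. The linear term carries the potential of the old
  density, the one that enters \<open>M\<close>.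
\<close>

lemma interaction_expansion:
  fixes u w :: "nat \<Rightarrow> real"
  assumes "\<And>x. W x = W (- x)"
  defines "d \<equiv> \<lambda>i. w i - u i"
  shows "(\<Sum>j=1..N. width xh j * interaction W N xh w j * w j) -
         (\<Sum>j=1..N. width xh j * interaction W N xh u j * u j) =
         2 * (\<Sum>j=1..N. width xh j * interaction W N xh u j * d j) +
         (\<Sum>j=1..N. width xh j * interaction W N xh d j * d j)"
  using interaction_symmetric[where W = W and N = N and xh = xh and u = u and v = w, OF assms(1)]
  unfolding d_def interaction_diff
  by (simp add: algebra_simps sum.distrib sum_subtractf)

text \<open>
  The explicit treatment of the interaction and the implicit treatment of the entropy combine to
  \<open>log w + V + g = log (w / M)\<close> with the old interaction potential \<open>g\<close>, so the first order terms
  add up to \<open>- \<tau>\<close> times the dissipation. The additive constant \<open>1\<close> from the derivative of the entropy is kept until the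
  summation by parts, where it drops out.
\<close>

lemma free_energy_increment:
  assumes W_even: "\<And>x. W x = W (- x)" and mesh: "mesh a b N xh" and tau: "\<tau> > 0"
    and step: "scheme_step V W N xh \<tau> u w"
    and u: "\<And>j. j \<in> {1..N} \<Longrightarrow> u j \<ge> 0" and w: "\<And>j. j \<in> {1..N} \<Longrightarrow> w j > 0"
  shows "free_energy V W N xh w - free_energy V W N xh u \<le>
           - \<tau> * dissipation V W N xh u w +
           1/2 * (\<Sum>j=1..N. width xh j * interaction W N xh (\<lambda>i. w i - u i) j * (w j - u j))"
proof -
  let ?h = "width xh" and ?g = "interaction W N xh u" and ?V = "\<lambda>j. V (center xh j)"
  let ?q = "rel_density V W N xh u w" and ?F = "flux V W N xh u w"
  let ?R = "\<Sum>j=1..N. ?h j * interaction W N xh (\<lambda>i. w i - u i) j * (w j - u j)"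
  have split: "free_energy V W N xh v =
      (\<Sum>j=1..N. ?h j * (v j * ln (v j))) + (\<Sum>j=1..N. ?h j * ?V j * v j)
      + 1/2 * (\<Sum>j=1..N. ?h j * interaction W N xh v j * v j)" for v
    by (simp add: free_energy_def sum.distrib sum_distrib_left distrib_left mult_ac)
  have ent: "(\<Sum>j=1..N. ?h j * (w j * ln (w j))) - (\<Sum>j=1..N. ?h j * (u j * ln (u j)))
      \<le> (\<Sum>j=1..N. ?h j * ((w j - u j) * (1 + ln (w j))))"
    unfolding sum_subtractf[symmetric] right_diff_distrib[symmetric]
    using u w width_pos[OF mesh]
    by (intro sum_mono mult_left_mono entropy_convexity) (auto simp: less_imp_le)
  have "free_energy V W N xh w - free_energy V W N xh u \<le>
      (\<Sum>j=1..N. ?h j * ((w j - u j) * (1 + ln (w j)))) +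
      (\<Sum>j=1..N. ?h j * ?V j * (w j - u j)) +
      (\<Sum>j=1..N. ?h j * ?g j * (w j - u j)) + 1/2 * ?R"
    using ent interaction_expansion[where W = W and N = N and xh = xh and u = u and w = w, OF W_even]
    unfolding split by (simp add: right_diff_distrib sum_subtractf)
  also have "(\<Sum>j=1..N. ?h j * ((w j - u j) * (1 + ln (w j)))) +
      (\<Sum>j=1..N. ?h j * ?V j * (w j - u j)) + (\<Sum>j=1..N. ?h j * ?g j * (w j - u j))
      = (\<Sum>j=1..N. ?h j * (w j - u j) * (1 + ln (?q j)))"
    unfolding sum.distrib[symmetric]
  proof (rule sum.cong[OF refl])
    fix j assume "j \<in> {1..N}"
    hence "ln (?q j) = ln (w j) + ?V j + ?g j"
      using w[of j] M_cell_pos[of V W N xh u j]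
      by (simp add: rel_density_def ln_div ln_M_cell)
    thus "?h j * ((w j - u j) * (1 + ln (w j))) + ?h j * ?V j * (w j - u j)
        + ?h j * ?g j * (w j - u j) = ?h j * (w j - u j) * (1 + ln (?q j))"
      by (simp add: algebra_simps)
  qed
  also have "(\<Sum>j=1..N. ?h j * (w j - u j) * (1 + ln (?q j)))
      = \<tau> * (\<Sum>j=1..N. (?F j - ?F (j - 1)) * (1 + ln (?q j)))"
    using scheme_step_balance[OF mesh tau step] by (simp add: sum_distrib_left mult_ac)
  also have "\<dots> = - \<tau> * dissipation V W N xh u w"
    by (subst summation_by_parts) (simp_all add: dissipation_def rel_density_def)
  finally show ?thesis by simp
qed

section \<open>The remainder against the dissipation\<close>

text \<open>
  By \<open>log s \<le> s - 1\<close>, the slope of the logarithm between \<open>x \<le> y\<close> is at least \<open>1 / y\<close>.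
\<close>

lemma log_difference_lower_bound:
  fixes x y Q :: real
  assumes "0 < x" "0 < y" "x \<le> Q" "y \<le> Q"
  shows "(y - x)\<^sup>2 \<le> Q * ((y - x) * (ln y - ln x))"
proof -
  have *: "(y - x)\<^sup>2 \<le> Q * ((y - x) * (ln y - ln x))"
    if "0 < x" "x \<le> y" "y \<le> Q" for x y :: real
  proof -
    have "1 - x / y \<le> ln y - ln x"
      using that ln_le_minus_one[of "x / y"] by (simp add: ln_div)
    hence "y * (1 - x / y) \<le> y * (ln y - ln x)"
      using that by (intro mult_left_mono) auto
    also have "\<dots> \<le> Q * (ln y - ln x)"
      using that by (intro mult_right_mono) auto
    finally have "y - x \<le> Q * (ln y - ln x)"
      using that by (simp add: right_diff_distrib)
    hence "(y - x) * (y - x) \<le> (y - x) * (Q * (ln y - ln x))"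
      using that by (intro mult_left_mono) auto
    thus ?thesis by (simp add: power2_eq_square mult_ac)
  qed
  show ?thesis
  proof (cases "x \<le> y")
    case True
    thus ?thesis using * assms by simp
  next
    case False
    with *[of y x] assms show ?thesis
      by (simp add: power2_commute[of y] algebra_simps)
  qed
qed

lemma quadratic_form_bound:
  fixes K :: "'i \<Rightarrow> 'i \<Rightarrow> real"
  assumes "finite A"
  shows "\<bar>\<Sum>j\<in>A. \<Sum>i\<in>A. K i j * z i * z j\<bar> \<le> (\<Sum>j\<in>A. \<Sum>i\<in>A. \<bar>K i j\<bar>) * (\<Sum>j\<in>A. \<bar>z j\<bar>)\<^sup>2"
proof -
  let ?S = "\<Sum>j\<in>A. \<bar>z j\<bar>"
  have "\<bar>\<Sum>j\<in>A. \<Sum>i\<in>A. K i j * z i * z j\<bar> \<le> (\<Sum>j\<in>A. \<Sum>i\<in>A. \<bar>K i j * z i * z j\<bar>)"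
    by (intro order_trans[OF sum_abs] sum_mono sum_abs)
  also have "\<dots> \<le> (\<Sum>j\<in>A. \<Sum>i\<in>A. \<bar>K i j\<bar> * ?S\<^sup>2)"
  proof (intro sum_mono)
    fix i j assume "i \<in> A" "j \<in> A"
    hence "\<bar>z i\<bar> \<le> ?S" "\<bar>z j\<bar> \<le> ?S"
      using assms by (auto intro!: member_le_sum[of _ A "\<lambda>j. \<bar>z j\<bar>"])
    hence "\<bar>z i\<bar> * \<bar>z j\<bar> \<le> ?S * ?S" by (intro mult_mono) auto
    thus "\<bar>K i j * z i * z j\<bar> \<le> \<bar>K i j\<bar> * ?S\<^sup>2"
      by (simp add: abs_mult power2_eq_square mult.assoc mult_left_mono)
  qed
  finally show ?thesis by (simp add: sum_distrib_right)
qed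

text \<open>
  Each flux enters two neighbouring increments, which gives the factor \<open>2\<^sup>2\<close>; the Cauchy-Schwarz
  inequality gives \<open>N\<close>.
\<close>

lemma sum_increments_squared_bound:
  fixes F :: "nat \<Rightarrow> real"
  assumes "F 0 = 0" "F N = 0"
  shows "(\<Sum>j=1..N. \<bar>F j - F (j - 1)\<bar>)\<^sup>2 \<le> 4 * real N * (\<Sum>j=1..N - 1. (F j)\<^sup>2)"
proof -
  have last: "(\<Sum>j=1..N. G j) = (\<Sum>j=1..N - 1. G j)" if "G N = 0" for G :: "nat \<Rightarrow> real"
    using that by (cases N) auto
  have shift: "(\<Sum>j=1..m. \<bar>F (j - 1)\<bar>) \<le> (\<Sum>j=1..m. \<bar>F j\<bar>)" for m
  proof -
    have "(\<Sum>j=1..m. \<bar>F (j - 1)\<bar>) + \<bar>F m\<bar> = (\<Sum>j=1..m. \<bar>F j\<bar>)"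
      by (induction m) (simp_all add: assms(1))
    thus ?thesis by linarith
  qed
  have "(\<Sum>j=1..N. \<bar>F j - F (j - 1)\<bar>) \<le> (\<Sum>j=1..N. \<bar>F j\<bar>) + (\<Sum>j=1..N. \<bar>F (j - 1)\<bar>)"
    unfolding sum.distrib[symmetric] by (intro sum_mono) linarith
  also have "\<dots> \<le> 2 * (\<Sum>j=1..N. \<bar>F j\<bar>)" using shift[of N] by simp
  finally have "(\<Sum>j=1..N. \<bar>F j - F (j - 1)\<bar>)\<^sup>2 \<le> (2 * (\<Sum>j=1..N. \<bar>F j\<bar>))\<^sup>2"
    by (intro power_mono) (auto intro: sum_nonneg)
  also have "\<dots> = 4 * (\<Sum>j=1..N. \<bar>F j\<bar>)\<^sup>2" by (simp add: power_mult_distrib)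
  also have "\<dots> \<le> 4 * (real N * (\<Sum>j=1..N. (F j)\<^sup>2))"
    using sum_squared_le_sum_of_squares[where I = "{1..N}" and f = "\<lambda>j. \<bar>F j\<bar>"]
    by (simp add: mult.commute)
  also have "(\<Sum>j=1..N. (F j)\<^sup>2) = (\<Sum>j=1..N - 1. (F j)\<^sup>2)"
    by (rule last) (simp add: assms)
  finally show ?thesis by simp
qed

text \<open>
  The balance law turns \<open>h (w - u)\<close> into \<open>\<tau>\<close> times flux increments. The remainder is therefore of
  second order in \<open>\<tau>\<close>, whereas the dissipation enters the energy balance with a single factor \<open>\<tau>\<close>.
\<close>

lemma remainder_bound:
  assumes mesh: "mesh a b N xh" and tau: "\<tau> > 0" and step: "scheme_step V W N xh \<tau> u w"
  shows "(\<Sum>j=1..N. width xh j * interaction W N xh (\<lambda>i. w i - u i) j * (w j - u j)) \<le>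
           \<tau>\<^sup>2 * (4 * real N * (\<Sum>j=1..N. \<Sum>i=1..N. \<bar>W (center xh i - center xh j)\<bar>) *
             (\<Sum>j=1..N - 1. (flux V W N xh u w j)\<^sup>2))"
proof -
  let ?F = "flux V W N xh u w" and ?z = "\<lambda>j. width xh j * (w j - u j)"
  let ?K = "\<lambda>i j. W (center xh i - center xh j)"
  let ?L = "\<Sum>j=1..N. \<Sum>i=1..N. \<bar>?K i j\<bar>"
  have "(\<Sum>j=1..N. width xh j * interaction W N xh (\<lambda>i. w i - u i) j * (w j - u j))
        = (\<Sum>j=1..N. \<Sum>i=1..N. ?K i j * ?z i * ?z j)"
    unfolding interaction_def sum_distrib_left sum_distrib_right
    by (intro sum.cong refl) (simp add: mult_ac)
  also have "\<dots> \<le> ?L * (\<Sum>j=1..N. \<bar>?z j\<bar>)\<^sup>2"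
    using quadratic_form_bound[of "{1..N}" ?K ?z] by simp
  also have "(\<Sum>j=1..N. \<bar>?z j\<bar>) = \<tau> * (\<Sum>j=1..N. \<bar>?F j - ?F (j - 1)\<bar>)"
    using scheme_step_balance[OF mesh tau step] tau
    by (simp add: sum_distrib_left abs_mult)
  also have "?L * (\<tau> * (\<Sum>j=1..N. \<bar>?F j - ?F (j - 1)\<bar>))\<^sup>2
        \<le> ?L * (\<tau>\<^sup>2 * (4 * real N * (\<Sum>j=1..N - 1. (?F j)\<^sup>2)))"
    unfolding power_mult_distrib
    by (intro mult_left_mono sum_increments_squared_bound sum_nonneg) auto
  finally show ?thesis by (simp add: mult_ac)
qed

text \<open>
  Each summand of the dissipation is \<open>k \<Delta>q \<Delta>(log q)\<close>, which dominates \<open>k (\<Delta>q)\<^sup>2 / Q\<close>, that is, the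
  squared flux divided by \<open>k Q\<close>.
\<close>

lemma flux_squared_le_dissipation:
  assumes mesh: "mesh a b N xh"
    and w: "\<And>j. j \<in> {1..N} \<Longrightarrow> w j > 0"
    and Q: "\<And>j. j \<in> {1..N} \<Longrightarrow> rel_density V W N xh u w j \<le> Q"
  shows "(\<Sum>j=1..N - 1. (flux V W N xh u w j)\<^sup>2) \<le>
           (\<Sum>j=1..N - 1. conductance V W N xh u j) * Q * dissipation V W N xh u w"
    and "dissipation V W N xh u w \<ge> 0"
proof -
  let ?q = "rel_density V W N xh u w" and ?F = "flux V W N xh u w"
  let ?k = "conductance V W N xh u" and ?D = "\<lambda>j. ?F j * (ln (?q (j + 1)) - ln (?q j))"
  have diss: "dissipation V W N xh u w = (\<Sum>j=1..N - 1. ?D j)"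
    by (simp add: dissipation_def rel_density_def)
  have q: "0 < ?q j" if "j \<in> {1..N}" for j
    using w[OF that] M_cell_pos[of V W N xh u j] by (simp add: rel_density_def)
  have N: "1 \<in> {1..N}" using mesh by (simp add: mesh_def)
  have Q0: "0 < Q" using q[OF N] Q[OF N] by simp
  have k: "0 < ?k j" if "j \<in> {1..N - 1}" for j
    using that by (intro conductance_pos[OF mesh]) auto
  have sq: "(?F j)\<^sup>2 \<le> ?k j * Q * ?D j" if "j \<in> {1..N - 1}" for j
  proof -
    have F: "?F j = ?k j * (?q (j + 1) - ?q j)"
      using that by (intro flux_eq_conductance) auto
    have j: "j \<in> {1..N}" "j + 1 \<in> {1..N}" using that by auto
    have "(?k j)\<^sup>2 * (?q (j + 1) - ?q j)\<^sup>2 \<le>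
          (?k j)\<^sup>2 * (Q * ((?q (j + 1) - ?q j) * (ln (?q (j + 1)) - ln (?q j))))"
      by (intro mult_left_mono log_difference_lower_bound q Q j) auto
    thus ?thesis unfolding F by (simp add: power2_eq_square mult_ac)
  qed
  have D: "0 \<le> ?D j" if "j \<in> {1..N - 1}" for j
  proof -
    have "0 < ?k j * Q" using k[OF that] Q0 by simp
    moreover have "0 \<le> ?k j * Q * ?D j" using order_trans[OF zero_le_power2 sq[OF that]] .
    ultimately show ?thesis by (meson linorder_not_le mult_pos_neg)
  qed
  show "dissipation V W N xh u w \<ge> 0"
    unfolding diss by (intro sum_nonneg D)
  have "(\<Sum>j=1..N - 1. (?F j)\<^sup>2) \<le> (\<Sum>j=1..N - 1. (\<Sum>j=1..N - 1. ?k j) * Q * ?D j)"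
  proof (rule sum_mono)
    fix j assume j: "j \<in> {1..N - 1}"
    have "?k j \<le> (\<Sum>j=1..N - 1. ?k j)"
      using k by (intro member_le_sum[OF j]) (auto intro: less_imp_le)
    hence "?k j * Q * ?D j \<le> (\<Sum>j=1..N - 1. ?k j) * Q * ?D j"
      using Q0 D[OF j] by (intro mult_right_mono) auto
    with sq[OF j] show "(?F j)\<^sup>2 \<le> (\<Sum>j=1..N - 1. ?k j) * Q * ?D j" by linarith
  qed
  thus "(\<Sum>j=1..N - 1. (?F j)\<^sup>2) \<le> (\<Sum>j=1..N - 1. ?k j) * Q * dissipation V W N xh u w"
    by (simp add: diss sum_distrib_left)
qed

lemma entropy_dissipation:
  assumes W_even: "\<And>x. W x = W (- x)" and mesh: "mesh a b N xh"
    and u: "\<And>j. j \<in> {1..N} \<Longrightarrow> u j \<ge> 0" and nz: "\<exists>j\<in>{1..N}. u j \<noteq> 0"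
  shows "\<exists>\<tau>\<^sub>m>0. \<forall>\<tau>. 0 < \<tau> \<and> \<tau> < \<tau>\<^sub>m \<longrightarrow>
          (\<forall>w. scheme_step V W N xh \<tau> u w \<longrightarrow>
             free_energy V W N xh w - free_energy V W N xh u
               \<le> - (\<tau> / 2) * dissipation V W N xh u w
             \<and> dissipation V W N xh u w \<ge> 0)"
proof -
  define Q where "Q = (\<Sum>j=1..N. width xh j * u j) * (\<Sum>j=1..N. 1 / (width xh j * M_cell V W N xh u j))"
  define k where "k = (\<Sum>j=1..N - 1. conductance V W N xh u j)"
  define L where "L = 4 * real N * (\<Sum>j=1..N. \<Sum>i=1..N. \<bar>W (center xh i - center xh j)\<bar>)"
  have Q: "0 \<le> Q"
    unfolding Q_def using u width_pos[OF mesh] M_cell_pos[of V W N xh u]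
    by (intro mult_nonneg_nonneg sum_nonneg) (auto simp: less_imp_le)
  have k: "0 \<le> k"
    unfolding k_def by (rule sum_nonneg, rule less_imp_le, rule conductance_pos[OF mesh]) auto
  have L: "0 \<le> L"
    unfolding L_def by (intro mult_nonneg_nonneg sum_nonneg) auto
  have LkQ: "0 \<le> L * (k * Q)" using Q k L by simp
  have main: "free_energy V W N xh w - free_energy V W N xh u
               \<le> - (\<tau> / 2) * dissipation V W N xh u w
             \<and> dissipation V W N xh u w \<ge> 0"
    if tau: "0 < \<tau>" "\<tau> < 1 / (L * (k * Q) + 1)" and step: "scheme_step V W N xh \<tau> u w" for \<tau> w
  proof -
    let ?I = "dissipation V W N xh u w" and ?S = "\<Sum>j=1..N - 1. (flux V W N xh u w j)\<^sup>2"
    let ?R = "\<Sum>j=1..N. width xh j * interaction W N xh (\<lambda>i. w i - u i) j * (w j - u j)"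
    have w: "w j > 0" if "j \<in> {1..N}" for j
      by (rule scheme_step_pos[OF mesh tau(1) step u nz that])
    have q: "rel_density V W N xh u w j \<le> Q" if "j \<in> {1..N}" for j
      unfolding Q_def by (rule rel_density_bound[OF mesh tau(1) step u that])
    have S: "?S \<le> k * Q * ?I" and I: "0 \<le> ?I"
      using flux_squared_le_dissipation[OF mesh w q] by (simp_all add: k_def)
    have "\<tau> * (L * (k * Q)) \<le> \<tau> * (L * (k * Q) + 1)"
      using tau by simp
    also have "\<dots> \<le> 1"
      using tau LkQ by (simp add: field_simps)
    finally have small: "\<tau> * (L * (k * Q)) \<le> 1" .
    have "?R \<le> \<tau>\<^sup>2 * (L * ?S)"
      using remainder_bound[OF mesh tau(1) step] by (simp add: L_def)
    also have "\<dots> \<le> \<tau>\<^sup>2 * (L * (k * Q * ?I))"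
      by (intro mult_left_mono S L) auto
    also have "\<dots> = \<tau> * ((\<tau> * (L * (k * Q))) * ?I)"
      by (simp add: power2_eq_square mult_ac)
    also have "\<dots> \<le> \<tau> * (1 * ?I)"
      using tau I small by (intro mult_left_mono mult_right_mono) auto
    finally have "?R \<le> \<tau> * ?I" by simp
    with free_energy_increment[of W, OF W_even mesh tau(1) step u w] I show ?thesis
      by (simp add: field_simps)
  qed
  \<comment> \<open>The summand \<open>1\<close> keeps the threshold well defined when \<open>L k Q = 0\<close>, for instance for \<open>W = 0\<close>.\<close>
  show ?thesis
    using main LkQ by (intro exI[of _ "1 / (L * (k * Q) + 1)"]) auto
qed

theorem theorem3p1:
  fixes V W :: "real \<Rightarrow> real" and a b :: real and N :: nat and xh :: "nat \<Rightarrow> real"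
  assumes W_even: "\<And>x. W x = W (- x)"
    and mesh: "mesh a b N xh"
  shows
    "(\<forall>\<tau>>0. \<forall>(\<rho>\<^sub>0 :: real \<Rightarrow> real) (\<rho> :: nat \<Rightarrow> nat \<Rightarrow> real).
       \<rho>\<^sub>0 absolutely_integrable_on {a..b} \<longrightarrow>
       (\<forall>j\<in>{1..N}. \<rho> 0 j = 1 / width xh j * (LINT x:cell xh j|lebesgue. \<rho>\<^sub>0 x)) \<longrightarrow>
       (\<forall>n. scheme_step V W N xh \<tau> (\<rho> n) (\<rho> (n + 1))) \<longrightarrow>
       (\<forall>n\<ge>1. (\<Sum>j=1..N. width xh j * \<rho> n j) = (LINT x:{a..b}|lebesgue. \<rho>\<^sub>0 x)))
   \<and>
    (\<forall>\<tau>>0. \<forall>u w :: nat \<Rightarrow> real.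
       scheme_step V W N xh \<tau> u w \<longrightarrow>
       (\<forall>j\<in>{1..N}. u j \<ge> 0) \<longrightarrow>
       (\<forall>j\<in>{1..N}. w j \<ge> 0))
   \<and>
    (\<forall>u :: nat \<Rightarrow> real.
       (\<forall>j\<in>{1..N}. u j \<ge> 0) \<longrightarrow> (\<exists>j\<in>{1..N}. u j \<noteq> 0) \<longrightarrow>
       (\<exists>\<tau>\<^sub>m>0. \<forall>\<tau>. 0 < \<tau> \<and> \<tau> < \<tau>\<^sub>m \<longrightarrow>
          (\<forall>w :: nat \<Rightarrow> real. scheme_step V W N xh \<tau> u w \<longrightarrow>
             free_energy V W N xh w - free_energy V W N xh u
               \<le> - (\<tau> / 2) * dissipation V W N xh u w
             \<and> dissipation V W N xh u w \<ge> 0)))"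
proof (intro conjI allI impI ballI)
  fix \<tau> :: real and \<rho>\<^sub>0 :: "real \<Rightarrow> real" and \<rho> :: "nat \<Rightarrow> nat \<Rightarrow> real" and n :: nat
  assume tau: "0 < \<tau>" and int: "\<rho>\<^sub>0 absolutely_integrable_on {a..b}"
    and init: "\<forall>j\<in>{1..N}. \<rho> 0 j = 1 / width xh j * (LINT x:cell xh j|lebesgue. \<rho>\<^sub>0 x)"
    and step: "\<forall>n. scheme_step V W N xh \<tau> (\<rho> n) (\<rho> (n + 1))"
  have "(\<Sum>j=1..N. width xh j * \<rho> n j) = (\<Sum>j=1..N. width xh j * \<rho> 0 j)"
  proof (induction n)
    case (Suc n)
    with mass_conservation[OF mesh tau step[rule_format, of n]] show ?case by simp
  qed simp
  also have "\<dots> = (\<Sum>j=1..N. LINT x:cell xh j|lebesgue. \<rho>\<^sub>0 x)"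
  proof (rule sum.cong[OF refl])
    fix j assume "j \<in> {1..N}"
    with init width_pos[OF mesh] show "width xh j * \<rho> 0 j = (LINT x:cell xh j|lebesgue. \<rho>\<^sub>0 x)"
      by fastforce
  qed
  also have "\<dots> = (LINT x:{a..b}|lebesgue. \<rho>\<^sub>0 x)"
    by (rule sum_cell_integrals[OF mesh int])
  finally show "(\<Sum>j=1..N. width xh j * \<rho> n j) = (LINT x:{a..b}|lebesgue. \<rho>\<^sub>0 x)" .
next
  fix \<tau> :: real and u w :: "nat \<Rightarrow> real" and j
  assume "0 < \<tau>" "scheme_step V W N xh \<tau> u w" "\<forall>j\<in>{1..N}. 0 \<le> u j" "j \<in> {1..N}"
  thus "0 \<le> w j" using scheme_step_nonneg[OF mesh] by blast
next
  fix u :: "nat \<Rightarrow> real"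
  assume "\<forall>j\<in>{1..N}. 0 \<le> u j" "\<exists>j\<in>{1..N}. u j \<noteq> 0"
  thus "\<exists>\<tau>\<^sub>m>0. \<forall>\<tau>. 0 < \<tau> \<and> \<tau> < \<tau>\<^sub>m \<longrightarrow>
          (\<forall>w :: nat \<Rightarrow> real. scheme_step V W N xh \<tau> u w \<longrightarrow>
             free_energy V W N xh w - free_energy V W N xh u
               \<le> - (\<tau> / 2) * dissipation V W N xh u w
             \<and> dissipation V W N xh u w \<ge> 0)"
    by (intro entropy_dissipation[of W, OF W_even mesh]) auto
qed

end
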